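(* Let $x_o\in\mathcal T\setminus\mathrm{int}\,\mathcal T$ and suppose that $\mathcal T\cap B_R(x_o)=\{x\in B_R(x_o):u(x)\le u(x_o)\}$, where for some integer $k>0$, $u\in C^k(\mathbb R^n)$ and $\nabla u(x_o)\ne 0$. Suppose that $u$ has $k$-th order decrease rate at $x_o$, i.e. there are available vector fields $f_i\in C^{k-1}(\mathbb R^n;\mathbb R^n)$, $i=1,\dots,m$, such that $$(H_{f_1}\boxplus\dots\boxplus H_{f_m})^k u(x_o)<0\quad\text{and}\quad (H_{f_1}\boxplus\dots\boxplus H_{f_m})^j u(x_o)=0\ \text{ for } j=1,\dots,k-1.$$ Then there are $\delta,\delta'>0$ and a constant $K>0$ such that for any $x\in\mathbb R^n$ with $|x-x_o|\le\delta'$ we can find $t\in[0,\delta]$ such that, if $(x_s)_{s\in[0,mt]}$ is the trajectory starting at $x$ and obtained by using the vector fields $f_1,\dots,f_m$ on subsequent intervals of length $t$ (that is, $\dot x_s=f_i(x_s)$ for $s\in[(i-1)t,it)$, $i=1,\dots,m$), then $x_{mt}\in B_R(x_o)$, $u(x_{mt})\le u(x_o)$, and moreover $$t\le K|x-x_o|^{1/k}.$$ In particular the minimum time function $T$ to reach the target $\mathcal T$ satisfies $$T(x)\le Km|x-x_o|^{1/k},\quad x\in B_{\delta'}(x_o),$$ and thus it is continuous at $x_o$ and the target is STLA at $x_o$.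
   Context: Control system: $\dot x_t=F(x_t,a_t)$, $x_0=x\in\mathbb R^n$, where $A$ is a compact subset of a metric space, $F:\mathbb R^n\times A\to\mathbb R^n$ is continuous, and there are $R,L>0$ with $|F(x,a)-F(y,a)|\le L|x-y|$ for all $x,y\in B_R(x_o)$, $a\in A$. Here $B_r(x_o)=\{x:|x-x_o|\le r\}$. It is a standing assumption that the system guarantees existence, uniqueness and uniform boundedness of trajectories. A vector field $f:\mathbb R^n\to\mathbb R^n$ is available if there is $a\in A$ with $f(x)=F(x,a)$ for all $x$. The target $\mathcal T\subset\mathbb R^n$ is a closed set. The minimum time function is $T(x)=\inf_{a_\cdot\in L^\infty((0,+\infty);A)}t_x(a)\in[0,+\infty]$, where $t_x(a)=\min\{t\ge0:x_t\in\mathcal T\}\ (\le+\infty)$ and $x_t$ is the trajectory with control $a_\cdot$ and initial point $x$. The target is STLA (small time locally attainable) at $x_o$ if $T$ is continuous at $x_o$ (note $T(x_o)=0$). For a vector field $f$ and a scalar function $u$, sufficiently smooth, put $H_f^{(0)}u=u$, $H_fu=f\cdot\nabla u$, $H_f^{(j+1)}u=H_f(H_f^{(j)}u)$. For vector fields $f_1,\dots,f_m$ and integer $r\ge0$, $$(H_{f_1}\boxplus\dots\boxplus H_{f_m})^r u=\sum_{i_1+\dots+i_m=r}\frac{r!}{i_1!\cdots i_m!}\,H_{f_1}^{(i_1)}\circ\dots\circ H_{f_m}^{(i_m)}u ,$$ with $i_1,\dots,i_m\ge0$ integers. *)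

theory Defs
  imports "HOL-Analysis.Analysis"
begin

section \<open>Smooth functions and iterated directional derivatives\<close>

definition grad :: "(real^'n \<Rightarrow> real) \<Rightarrow> real^'n \<Rightarrow> real^'n" where
  "grad u x = (\<chi> i. frechet_derivative u (at x) (axis i 1))"

lemma GDERIV_grad:
  fixes u :: "real^'n \<Rightarrow> real"
  assumes "u differentiable (at x)"
  shows "GDERIV u x :> grad u x"
proof -
  let ?D = "frechet_derivative u (at x)"
  have D: "(u has_derivative ?D) (at x)"
    using assms frechet_derivative_works by blast
  then interpret linear ?D
    by (rule has_derivative_linear)
  have "?D h = h \<bullet> grad u x" for h
  proof -
    have "?D h = ?D (\<Sum>i\<in>UNIV. h $ i *\<^sub>R axis i 1)"
      using basis_expansion[of h] by (simp add: scalar_mult_eq_scaleR)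
    also have "\<dots> = h \<bullet> grad u x"
      by (simp add: sum scale grad_def inner_vec_def)
    finally show ?thesis .
  qed
  then have "?D = (\<lambda>h. h \<bullet> grad u x)"
    by (rule ext)
  with D show ?thesis
    unfolding gderiv_def by simp
qed

text \<open>The class \<open>C\<^sup>k\<close> on the whole space: \<open>g\<close> is of class \<open>Ck (Suc k)\<close> if it is differentiable
  and its first-order partial derivatives are of class \<open>Ck k\<close>. No bound on the derivatives is imposed.\<close>

primrec Ck :: "nat \<Rightarrow> (real^'n \<Rightarrow> 'b::real_normed_vector) \<Rightarrow> bool" where
  "Ck 0 g \<longleftrightarrow> continuous_on UNIV g"
| "Ck (Suc k) g \<longleftrightarrow> (\<forall>x. g differentiable (at x)) \<and>
     (\<forall>i. Ck k (\<lambda>x. frechet_derivative g (at x) (axis i 1)))"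

definition H :: "(real^'n \<Rightarrow> real^'n) \<Rightarrow> (real^'n \<Rightarrow> real) \<Rightarrow> real^'n \<Rightarrow> real" where
  "H f u = (\<lambda>x. f x \<bullet> grad u x)"

text \<open>A multi-index is a function \<open>i\<close> on \<open>{1..m}\<close>. Bounding its values by \<open>r\<close> loses nothing,
  because they are naturals with sum \<open>r\<close>, and makes the index set visibly finite. The fold applies
  the powers belonging to \<open>f m\<close> first and those belonging to \<open>f 1\<close> last.\<close>

definition H_boxplus ::
  "nat \<Rightarrow> (nat \<Rightarrow> real^'n \<Rightarrow> real^'n) \<Rightarrow> nat \<Rightarrow> (real^'n \<Rightarrow> real) \<Rightarrow> real^'n \<Rightarrow> real" where
  "H_boxplus m f r u x =
     (\<Sum>i | i \<in> {1..m} \<rightarrow>\<^sub>E {..r} \<and> (\<Sum>j=1..m. i j) = r.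
        (fact r / (\<Prod>j=1..m. fact (i j))) *
        foldr (\<lambda>j. H (f j) ^^ i j) [1..<Suc m] u x)"


section \<open>The control system\<close>

text \<open>Representatives of the classes in \<open>L\<^sup>\<infinity>\<close> on the open half-line with values in \<open>A\<close>;
  essential boundedness is automatic for compact \<open>A\<close>.\<close>

definition controls :: "'c::metric_space set \<Rightarrow> (real \<Rightarrow> 'c) set" where
  "controls A = {a. a \<in> borel_measurable (lebesgue_on {0<..}) \<and> (\<forall>t>0. a t \<in> A)}"

text \<open>Caratheodory (locally absolutely continuous) solutions on the closed half-line, in integral form.\<close>

definition is_trajectory ::
  "(real^'n \<Rightarrow> 'c \<Rightarrow> real^'n) \<Rightarrow> (real \<Rightarrow> 'c) \<Rightarrow> real^'n \<Rightarrow> (real \<Rightarrow> real^'n) \<Rightarrow> bool" where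
  "is_trajectory F a x y \<longleftrightarrow>
     (\<forall>t\<ge>0. (\<lambda>s. F (y s) (a s)) absolutely_integrable_on {0..t} \<and>
            y t = x + integral {0..t} (\<lambda>s. F (y s) (a s)))"

text \<open>Existence, uniqueness and uniform boundedness of trajectories. The bound is uniform in the
  control, for a given initial point and a given finite time horizon.\<close>

definition well_posed :: "(real^'n \<Rightarrow> 'c::metric_space \<Rightarrow> real^'n) \<Rightarrow> 'c set \<Rightarrow> bool" where
  "well_posed F A \<longleftrightarrow>
     (\<forall>a\<in>controls A. \<forall>x. \<exists>y. is_trajectory F a x y) \<and>
     (\<forall>a\<in>controls A. \<forall>x y z. is_trajectory F a x y \<longrightarrow> is_trajectory F a x z \<longrightarrow>
        (\<forall>t\<ge>0. y t = z t)) \<and>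
     (\<forall>x. \<forall>\<tau>\<ge>0. \<exists>M. \<forall>a\<in>controls A. \<forall>y. is_trajectory F a x y \<longrightarrow>
        (\<forall>t\<in>{0..\<tau>}. norm (y t) \<le> M))"

definition trajectory ::
  "(real^'n \<Rightarrow> 'c \<Rightarrow> real^'n) \<Rightarrow> (real \<Rightarrow> 'c) \<Rightarrow> real^'n \<Rightarrow> real \<Rightarrow> real^'n" where
  "trajectory F a x = (SOME y. is_trajectory F a x y)"

definition available ::
  "(real^'n \<Rightarrow> 'c \<Rightarrow> real^'n) \<Rightarrow> 'c set \<Rightarrow> (real^'n \<Rightarrow> real^'n) \<Rightarrow> bool" where
  "available F A f \<longleftrightarrow> (\<exists>a\<in>A. \<forall>x. f x = F x a)"

text \<open>The infimum is a minimum when the target is closed and the trajectory hits it, and it is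
  \<open>\<infinity>\<close> when the target is never hit.\<close>

definition hitting_time :: "(real^'n) set \<Rightarrow> (real \<Rightarrow> real^'n) \<Rightarrow> ennreal" where
  "hitting_time \<T> y = (INF t \<in> {t. 0 \<le> t \<and> y t \<in> \<T>}. ennreal t)"

definition min_time ::
  "(real^'n \<Rightarrow> 'c::metric_space \<Rightarrow> real^'n) \<Rightarrow> 'c set \<Rightarrow> (real^'n) set \<Rightarrow> real^'n \<Rightarrow> ennreal" where
  "min_time F A \<T> x = (INF a \<in> controls A. hitting_time \<T> (trajectory F a x))"

definition STLA ::
  "(real^'n \<Rightarrow> 'c::metric_space \<Rightarrow> real^'n) \<Rightarrow> 'c set \<Rightarrow> (real^'n) set \<Rightarrow> real^'n \<Rightarrow> bool" where
  "STLA F A \<T> x\<^sub>o \<longleftrightarrow> isCont (min_time F A \<T>) x\<^sub>o"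

text \<open>\<open>y\<close> on \<open>[0, m t]\<close> follows \<open>f 1, \<dots>, f m\<close> in this order, each for time \<open>t\<close>. At a switching
  time the derivative is the right derivative.\<close>

definition switched_trajectory ::
  "nat \<Rightarrow> (nat \<Rightarrow> real^'n \<Rightarrow> real^'n) \<Rightarrow> real \<Rightarrow> real^'n \<Rightarrow> (real \<Rightarrow> real^'n) \<Rightarrow> bool" where
  "switched_trajectory m f t x y \<longleftrightarrow>
     y 0 = x \<and> continuous_on {0..real m * t} y \<and>
     (\<forall>i\<in>{1..m}. \<forall>s\<in>{(real i - 1) * t..<real i * t}.
        (y has_vector_derivative f i (y s)) (at s within {(real i - 1) * t..real i * t}))"

end

theory Submission
  imports Defs
begin

text \<open>The function \<open>u\<close>, evaluated after following \<open>f 1, \<dots>, f m\<close> for time \<open>t\<close> each, is a function of the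
  switching time \<open>t\<close> and the starting point \<open>x\<close>. Iterating Taylor's formula along the arcs, from the
  last one back to the first, shows that its Taylor polynomial in \<open>t\<close> has the coefficients
  \<open>H_boxplus m f q u x / q!\<close>, with a remainder \<open>o(t\<^sup>k)\<close> that is uniform for \<open>x\<close> near \<open>x\<^sub>o\<close>
  (\<open>switched_trajectory_expansion\<close>). The algebra behind this is a binomial recursion for
  \<open>H_boxplus\<close> in the number of fields (\<open>H_boxplus_Suc\<close>), the analysis is the Taylor formula on a
  single arc (\<open>taylor_along_integral_curve\<close>) and the fact that short trajectories starting near
  \<open>x\<^sub>o\<close> stay near \<open>x\<^sub>o\<close>.

  The coefficients of order below \<open>k\<close> are differentiable in \<open>x\<close>. At \<open>x\<^sub>o\<close> the one of order \<open>0\<close> is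
  \<open>u x\<^sub>o\<close> and the others vanish, so near \<open>x\<^sub>o\<close> they contribute at most \<open>u x\<^sub>o + C |x - x\<^sub>o|\<close>. The
  coefficient of order \<open>k\<close> is continuous and negative at \<open>x\<^sub>o\<close>, so it contributes about \<open>- c t\<^sup>k\<close>. With
  \<open>t = K |x - x\<^sub>o|\<^sup>1\<^sup>/\<^sup>k\<close> both effects are of the same order in \<open>|x - x\<^sub>o|\<close>, and for large \<open>K\<close> the
  decrease wins (\<open>decrease_along_switched_trajectories\<close>). The endpoint then lies in the sublevel set
  of \<open>u\<close>, that is, in the target.

  To compare with the minimum time, the switched motion is realized by a piecewise constant control:
  the trajectory of that control solves the differential equation of each field classically
  (\<open>is_trajectory_imp_switched_trajectory\<close>). It reaches the target at time \<open>m t\<close>, which bounds the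
  minimum time, and a function squeezed between \<open>0\<close> and a multiple of \<open>|x - x\<^sub>o|\<^sup>1\<^sup>/\<^sup>k\<close> is continuous
  at \<open>x\<^sub>o\<close>.\<close>

section \<open>Calculus of the classes \<open>C\<^sup>k\<close>\<close>

lemma Ck_SucD: "Ck (Suc k) g \<Longrightarrow> Ck k g"
proof (induction k arbitrary: g)
  case 0
  then show ?case
    by (auto intro!: continuous_at_imp_continuous_on differentiable_imp_continuous_within)
next
  case (Suc k)
  then show ?case by fastforce
qed

lemma Ck_antimono:
  assumes "Ck k g" and "j \<le> k"
  shows "Ck j g"
  using assms(2,1) by (induction rule: dec_induct) (use Ck_SucD in blast)+

lemma Ck_imp_continuous_on: "Ck k g \<Longrightarrow> continuous_on S g"
  using Ck_antimono[of k g 0] continuous_on_subset by fastforce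

text \<open>With a guessed derivative \<open>D\<close> the recursion for \<open>Ck\<close> can be entered without ever computing a
  \<open>frechet_derivative\<close>; closure under sums, products and components is obtained this way.\<close>

lemma Ck_SucI:
  assumes "\<And>x. (g has_derivative D x) (at x)" and "\<And>i. Ck k (\<lambda>x. D x (axis i 1))"
  shows "Ck (Suc k) g"
proof -
  have "frechet_derivative g (at x) = D x" for x
    by (rule frechet_derivative_at[OF assms(1), symmetric])
  moreover have "g differentiable (at x)" for x
    using assms(1)[of x] by (auto simp: differentiable_def)
  ultimately show ?thesis
    using assms(2) by simp
qed

lemma Ck_Suc_has_derivative:
  "Ck (Suc k) g \<Longrightarrow> (g has_derivative frechet_derivative g (at x)) (at x)"
  by (simp flip: frechet_derivative_works)

lemma Ck_Suc_partial: "Ck (Suc k) g \<Longrightarrow> Ck k (\<lambda>x. frechet_derivative g (at x) (axis i 1))"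
  by simp

lemma Ck_const: "Ck k (\<lambda>x. c)"
proof (induction k arbitrary: c)
  case (Suc k)
  show ?case
    by (rule Ck_SucI[OF has_derivative_const Suc.IH])
qed simp

lemma Ck_add: "Ck k g \<Longrightarrow> Ck k h \<Longrightarrow> Ck k (\<lambda>x. g x + h x)"
proof (induction k arbitrary: g h)
  case 0
  then show ?case by (auto intro: continuous_on_add)
next
  case (Suc k)
  show ?case
    by (intro Ck_SucI[OF has_derivative_add[OF Suc.prems[THEN Ck_Suc_has_derivative]]]
        Suc.IH Suc.prems[THEN Ck_Suc_partial])
qed

lemma Ck_mult:
  fixes g h :: "real^'n \<Rightarrow> real"
  shows "Ck k g \<Longrightarrow> Ck k h \<Longrightarrow> Ck k (\<lambda>x. g x * h x)"
proof (induction k arbitrary: g h)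
  case 0
  then show ?case by (auto intro: continuous_on_mult)
next
  case (Suc k)
  show ?case
    by (intro Ck_SucI[OF has_derivative_mult[OF Suc.prems[THEN Ck_Suc_has_derivative]]]
        Ck_add Suc.IH Suc.prems[THEN Ck_Suc_partial] Suc.prems[THEN Ck_SucD])
qed

lemma Ck_sum: "(\<And>i. i \<in> I \<Longrightarrow> Ck k (g i)) \<Longrightarrow> Ck k (\<lambda>x. \<Sum>i\<in>I. g i x)"
  by (induction I rule: infinite_finite_induct) (simp_all add: Ck_const Ck_add del: Ck.simps)

lemma Ck_component:
  fixes g :: "real^'n \<Rightarrow> real^'m"
  shows "Ck k g \<Longrightarrow> Ck k (\<lambda>x. g x $ j)"
proof (induction k arbitrary: g)
  case 0
  then show ?case by (auto intro: continuous_on_component)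
next
  case (Suc k)
  show ?case
    by (intro Ck_SucI[OF bounded_linear.has_derivative[OF bounded_linear_vec_nth
            Ck_Suc_has_derivative[OF Suc.prems]]] Suc.IH Ck_Suc_partial[OF Suc.prems])
qed

text \<open>A directional derivative costs one order of smoothness of \<open>w\<close> and, being a sum of products of
  components of \<open>f\<close> with partial derivatives of \<open>w\<close>, none of \<open>f\<close>. This is why \<open>C\<^sup>k\<close> for \<open>u\<close> and
  \<open>C\<^sup>k\<^sup>-\<^sup>1\<close> for the fields suffice to form all compositions of up to \<open>k\<close> operators \<open>H\<close>.\<close>

lemma Ck_H:
  assumes "Ck k f" and "Ck (Suc k) w"
  shows "Ck k (H f w)"
proof -
  have "H f w = (\<lambda>x. \<Sum>i\<in>UNIV. f x $ i * frechet_derivative w (at x) (axis i 1))"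
    by (auto simp: H_def grad_def inner_vec_def)
  with assms show ?thesis
    by (auto intro!: Ck_sum Ck_mult Ck_component Ck_Suc_partial simp del: Ck.simps)
qed

lemma Ck_H_funpow:
  assumes "Ck (k - 1) f" and "Ck k w" and "j \<le> k"
  shows "Ck (k - j) ((H f ^^ j) w)"
  using \<open>j \<le> k\<close>
proof (induction j)
  case 0
  then show ?case using assms by simp
next
  case (Suc j)
  then have "Ck (Suc (k - Suc j)) ((H f ^^ j) w)"
    by (simp add: Suc_diff_Suc del: Ck.simps(2))
  moreover have "Ck (k - Suc j) f"
    using assms(1) by (rule Ck_antimono) simp
  ultimately show ?case
    by (simp add: Ck_H)
qed

section \<open>One arc: confinement and Taylor expansion\<close>

text \<open>The differential equation is only asked for in the interior. Together with continuity at the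
  endpoints this is all the mean value theorem uses, and it makes the one-sided
  derivatives at switching times irrelevant.\<close>

definition integral_curve :: "(real^'n \<Rightarrow> real^'n) \<Rightarrow> real \<Rightarrow> real \<Rightarrow> (real \<Rightarrow> real^'n) \<Rightarrow> bool" where
  "integral_curve f a b y \<longleftrightarrow> continuous_on {a..b} y \<and>
     (\<forall>s\<in>{a<..<b}. (y has_vector_derivative f (y s)) (at s))"

lemma integral_curve_subinterval:
  "integral_curve f a b y \<Longrightarrow> b' \<le> b \<Longrightarrow> integral_curve f a b' y"
  unfolding integral_curve_def by (auto elim: continuous_on_subset)

lemma DERIV_along_integral_curve:
  assumes "integral_curve f a b y" and "s \<in> {a<..<b}" and "w differentiable (at (y s))"
  shows "((\<lambda>s. w (y s)) has_real_derivative H f w (y s)) (at s)"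
proof -
  have y: "(y has_derivative (\<lambda>h. h *\<^sub>R f (y s))) (at s)"
    using assms(1,2) by (auto simp: integral_curve_def has_vector_derivative_def)
  have "(w has_derivative (\<lambda>h. h \<bullet> grad w (y s))) (at (y s))"
    using GDERIV_grad[OF assms(3)] by (simp add: gderiv_def)
  from has_derivative_compose[OF y this] show ?thesis
    by (simp add: has_field_derivative_def H_def mult_commute_abs)
qed

lemma DERIV_power_over_fact:
  "((\<lambda>s. s ^ Suc j / fact (Suc j)) has_real_derivative (s ^ j / fact j)) (at s)"
proof -
  have "((\<lambda>s. s ^ Suc j / fact (Suc j)) has_real_derivative (real (Suc j) * s ^ j / fact (Suc j))) (at s)"
    by (auto intro!: derivative_eq_intros simp del: power_Suc fact_Suc)
  then show ?thesis
    by (simp add: field_simps del: of_nat_Suc power_Suc)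
qed

text \<open>Along a curve of \<open>f\<close> the derivatives of \<open>w\<close> are the functions \<open>H\<^sub>f\<^sup>j w\<close>, so this is Taylor's formula
  with Peano remainder. It is proved by induction on the order: the derivative in \<open>t\<close> of the
  remainder for \<open>w\<close> is the remainder of one order less for \<open>H f w\<close>, and the mean value theorem
  integrates the bound. At order \<open>0\<close> only continuity of \<open>H\<^sub>f\<^sup>r w\<close> at \<open>x\<^sub>o\<close> is left, which yields an \<open>\<eta>\<close>
  that depends neither on the starting point nor on the curve; this uniformity is essential,
  because the expansion is applied at points near \<open>x\<^sub>o\<close> and not at \<open>x\<^sub>o\<close> itself.\<close>

lemma taylor_along_integral_curve:
  fixes w :: "real^'n \<Rightarrow> real"
  assumes "Ck (r - 1) f" and "Ck r w" and "\<epsilon> > 0"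
  shows "\<exists>\<eta>>0. \<forall>a t y. t > 0 \<longrightarrow> integral_curve f a (a + t) y \<longrightarrow> y ` {a..a + t} \<subseteq> ball x\<^sub>o \<eta> \<longrightarrow>
    \<bar>w (y (a + t)) - (\<Sum>j\<le>r. t ^ j / fact j * (H f ^^ j) w (y a))\<bar> \<le> \<epsilon> * t ^ r"
  using assms(1,2)
proof (induction r arbitrary: w)
  case 0
  then have "isCont w x\<^sub>o"
    by (simp add: continuous_on_eq_continuous_at)
  then obtain \<eta> where \<eta>: "\<eta> > 0" "\<And>z. dist z x\<^sub>o < \<eta> \<Longrightarrow> dist (w z) (w x\<^sub>o) < \<epsilon> / 2"
    using \<open>\<epsilon> > 0\<close> unfolding continuous_at_eps_delta by (meson half_gt_zero)
  have "\<bar>w (y (a + t)) - w (y a)\<bar> \<le> \<epsilon>"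
    if "t > 0" "y ` {a..a + t} \<subseteq> ball x\<^sub>o \<eta>" for a t :: real and y
  proof -
    have "a + t \<in> {a..a + t}" "a \<in> {a..a + t}"
      using that by auto
    with that have "dist (y (a + t)) x\<^sub>o < \<eta>" "dist (y a) x\<^sub>o < \<eta>"
      by (metis dist_commute image_subset_iff mem_ball)+
    from this[THEN \<eta>(2)] show ?thesis
      unfolding dist_real_def by linarith
  qed
  with \<eta>(1) show ?case by auto
next
  case (Suc r)
  have diff: "w differentiable (at x)" for x
    using Suc.prems by simp
  have "Ck (r - 1) f" "Ck r (H f w)"
    using Suc.prems Ck_antimono[of r f "r - 1"] Ck_H[of r f w] by (auto simp del: Ck.simps(2))
  from Suc.IH[OF this] obtain \<eta> where \<eta>: "\<eta> > 0"
    and bound: "\<And>a t y. t > 0 \<Longrightarrow> integral_curve f a (a + t) y \<Longrightarrow> y ` {a..a + t} \<subseteq> ball x\<^sub>o \<eta> \<Longrightarrow>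
      \<bar>H f w (y (a + t)) - (\<Sum>j\<le>r. t ^ j / fact j * (H f ^^ j) (H f w) (y a))\<bar> \<le> \<epsilon> * t ^ r"
    by blast
  have "\<bar>w (y (a + t)) - (\<Sum>j\<le>Suc r. t ^ j / fact j * (H f ^^ j) w (y a))\<bar> \<le> \<epsilon> * t ^ Suc r"
    if t: "t > 0" and y: "integral_curve f a (a + t) y" and sub: "y ` {a..a + t} \<subseteq> ball x\<^sub>o \<eta>" for a t y
  proof -
    define e where "e s = w (y (a + s)) - (\<Sum>j\<le>Suc r. s ^ j / fact j * (H f ^^ j) w (y a))" for s
    define e' where "e' s = H f w (y (a + s)) - (\<Sum>j\<le>r. s ^ j / fact j * (H f ^^ j) (H f w) (y a))" for s
    have e_alt: "e = (\<lambda>s. w (y (a + s)) - (w (y a) +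
        (\<Sum>j\<le>r. s ^ Suc j / fact (Suc j) * (H f ^^ j) (H f w) (y a))))"
      unfolding e_def by (subst sum.atMost_Suc_shift) (simp add: funpow_swap1)
    have cont: "continuous_on {0..t} e"
    proof -
      have "continuous_on UNIV w"
        using Suc.prems(2) by (rule Ck_imp_continuous_on)
      moreover have "continuous_on {0..t} (\<lambda>s. y (a + s))"
        using y unfolding integral_curve_def
        by (auto intro!: continuous_on_compose2[of "{a..a+t}" y] continuous_intros)
      ultimately have "continuous_on {0..t} (\<lambda>s. w (y (a + s)))"
        by (rule continuous_on_compose2) simp
      then show ?thesis
        unfolding e_def by (intro continuous_intros) auto
    qed
    have deriv: "(e has_derivative (*) (e' s)) (at s)" if "0 < s" "s < t" for s
    proof -
      have "((\<lambda>s. w (y s)) has_real_derivative H f w (y (a + s))) (at (a + s))"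
        using y that diff by (intro DERIV_along_integral_curve) auto
      from DERIV_shift[THEN iffD1, OF this[unfolded add.commute[of a s]]]
      have "((\<lambda>s. w (y (a + s))) has_real_derivative H f w (y (a + s))) (at s)"
        by (simp add: add.commute)
      then have "(e has_real_derivative e' s) (at s)"
        unfolding e_alt e'_def
        by (intro derivative_eq_intros refl DERIV_power_over_fact DERIV_cmult_right) auto
      then show ?thesis
        by (simp add: has_field_derivative_def)
    qed
    obtain \<xi> where \<xi>: "0 < \<xi>" "\<xi> < t" "e t - e 0 = e' \<xi> * t"
      using mvt[OF t cont deriv] by auto
    have "\<bar>e' \<xi>\<bar> \<le> \<epsilon> * \<xi> ^ r"
      unfolding e'_def using \<xi> sub
      by (intro bound integral_curve_subinterval[OF y]) (auto simp: image_subset_iff)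
    also have "\<dots> \<le> \<epsilon> * t ^ r"
      using \<xi> \<open>\<epsilon> > 0\<close> by (auto intro!: power_mono)
    finally have "\<bar>e t - e 0\<bar> \<le> \<epsilon> * t ^ r * t"
      using \<xi>(3) t by (simp add: abs_mult)
    moreover have "e 0 = 0"
      by (simp add: e_alt)
    ultimately show ?thesis
      by (simp add: e_def mult_ac)
  qed
  with \<eta> show ?case by blast
qed

text \<open>The field is bounded by some \<open>M\<close> on the compact ball of radius \<open>\<eta>\<close>, so a curve starting within
  \<open>\<eta> / 2\<close> of the centre needs at least time \<open>\<eta> / (2 M)\<close> to leave it. The field may be
  unbounded elsewhere, hence the argument looks at the first exit time.\<close>

lemma integral_curve_confined:
  assumes "continuous_on UNIV f" and "\<eta> > 0"
  shows "\<exists>\<tau>>0. \<forall>a b y. a \<le> b \<longrightarrow> b - a < \<tau> \<longrightarrow> integral_curve f a b y \<longrightarrow>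
    y a \<in> ball x\<^sub>o (\<eta> / 2) \<longrightarrow> y ` {a..b} \<subseteq> ball x\<^sub>o \<eta>"
proof -
  have "compact (f ` cball x\<^sub>o \<eta>)"
    using assms by (auto intro!: compact_continuous_image elim: continuous_on_subset)
  then obtain M where M: "M > 0" "\<And>z. z \<in> cball x\<^sub>o \<eta> \<Longrightarrow> norm (f z) \<le> M"
    by (auto dest!: compact_imp_bounded simp: bounded_pos)
  have "y ` {a..b} \<subseteq> ball x\<^sub>o \<eta>"
    if ab: "a \<le> b" "b - a < \<eta> / (2 * M)" and y: "integral_curve f a b y"
      and ya: "y a \<in> ball x\<^sub>o (\<eta> / 2)" for a b y
  proof (rule ccontr)
    assume escapes: "\<not> ?thesis"
    \<comment> \<open>Closedness of \<open>E\<close> makes the first exit time a minimum.\<close>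
    define E where "E = {s \<in> {a..b}. \<eta> \<le> dist x\<^sub>o (y s)}"
    have "continuous_on {a..b} y"
      using y by (simp add: integral_curve_def)
    then have "closed E"
      unfolding E_def by (intro continuous_on_closed_Collect_le continuous_intros) auto
    moreover have "E \<subseteq> {a..b}"
      by (auto simp: E_def)
    ultimately have "compact E"
      by (metis compact_Icc compact_Int_closed inf.absorb_iff2)
    moreover have "E \<noteq> {}"
      using escapes unfolding E_def image_subset_iff mem_ball by (force simp: not_less)
    ultimately have "\<exists>s\<in>E. \<forall>s'\<in>E. s \<le> s'"
      by (rule compact_attains_inf)
    then obtain s where s: "s \<in> E" "\<And>s'. s' \<in> E \<Longrightarrow> s \<le> s'"
      by blast
    have "s \<noteq> a"
      using s(1) ya \<open>\<eta> > 0\<close> by (auto simp: E_def)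
    then have "a < s" "s \<le> b"
      using s(1) by (auto simp: E_def)
    have ys: "integral_curve f a s y"
      using y \<open>s \<le> b\<close> by (rule integral_curve_subinterval)
    obtain \<xi> where \<xi>: "\<xi> \<in> {a<..<s}" "norm (y s - y a) \<le> norm ((s - a) *\<^sub>R f (y \<xi>))"
      using mvt_general[OF \<open>a < s\<close>, of y "\<lambda>\<xi> h. h *\<^sub>R f (y \<xi>)"] ys
      by (auto simp: integral_curve_def has_vector_derivative_def)
    have "\<xi> \<notin> E"
      using s(2) \<xi>(1) by fastforce
    then have "norm (f (y \<xi>)) \<le> M"
      using \<xi>(1) \<open>s \<le> b\<close> by (intro M) (auto simp: E_def)
    then have "norm ((s - a) *\<^sub>R f (y \<xi>)) \<le> (b - a) * M"
      using \<open>a < s\<close> \<open>s \<le> b\<close> by (auto intro!: mult_mono)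
    also have "\<dots> < \<eta> / 2"
      using ab M(1) by (simp add: field_simps)
    finally have "dist (y a) (y s) < \<eta> / 2"
      using \<xi>(2) by (simp add: dist_norm norm_minus_commute)
    with ya have "dist x\<^sub>o (y s) < \<eta>"
      using dist_triangle[of x\<^sub>o "y s" "y a"] by (simp add: dist_commute)
    with s(1) show False
      by (simp add: E_def)
  qed
  moreover have "\<eta> / (2 * M) > 0"
    using M \<open>\<eta> > 0\<close> by simp
  ultimately show ?thesis by blast
qed

section \<open>Recursion for the Taylor coefficients in the number of fields\<close>

lemma finite_multi_indices: "finite {i. i \<in> {1..n::nat} \<rightarrow>\<^sub>E {..r::nat} \<and> (\<Sum>l=1..n. i l) = r}"
  by (rule finite_subset[of _ "{1..n} \<rightarrow>\<^sub>E {..r}"]) (auto intro!: finite_PiE)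

lemma H_boxplus_no_fields: "H_boxplus 0 f r w x = (if r = 0 then w x else 0)"
proof (cases "r = 0")
  case True
  have "{i. i \<in> {1..0::nat} \<rightarrow>\<^sub>E {..r} \<and> (\<Sum>l=1..0. i l) = r} = {\<lambda>_. undefined}"
    using True by auto
  then show ?thesis
    unfolding H_boxplus_def using True by simp
next
  case False
  then show ?thesis
    unfolding H_boxplus_def by simp
qed

text \<open>Splitting off the exponent \<open>j\<close> of the last field from the multi-index: it belongs to the operator
  that is applied to \<open>w\<close> first, and the multinomial coefficient factors as a binomial coefficient times
  the multinomial coefficient of the remaining exponents. This recursion replaces any further
  handling of multi-indices.\<close>

lemma H_boxplus_Suc:
  "H_boxplus (Suc n) f r w x =
    (\<Sum>j\<le>r. real (r choose j) * H_boxplus n f (r - j) ((H (f (Suc n)) ^^ j) w) x)"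
proof -
  \<comment> \<open>The multi-indices for \<open>Suc n\<close> fields correspond to pairs of a last exponent and a
    multi-index for \<open>n\<close> fields.\<close>
  define S where "S n r = {i. i \<in> {1..n} \<rightarrow>\<^sub>E {..r} \<and> (\<Sum>l=1..n. i l) = r}" for n r :: nat
  have S_le: "i l \<le> r" if "i \<in> S n r" "1 \<le> l" "l \<le> n" for i l n r
    using that by (auto simp: S_def PiE_iff)
  define T where "T n i w = foldr (\<lambda>l. H (f l) ^^ i l) [1..<Suc n] w x" for n i w
  have T_upd: "T (Suc n) (i(Suc n := j)) w = T n i ((H (f (Suc n)) ^^ j) w)" for i j
  proof -
    have "foldr (\<lambda>l. H (f l) ^^ (i(Suc n := j)) l) [1..<Suc n] v =
        foldr (\<lambda>l. H (f l) ^^ i l) [1..<Suc n] v" for v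
      by (rule foldr_cong) auto
    moreover have "[1..<Suc (Suc n)] = [1..<Suc n] @ [Suc n]"
      by simp
    ultimately show ?thesis
      by (simp add: T_def del: upt_Suc)
  qed
  have sum_upd: "(\<Sum>l=1..n. (i(Suc n := j)) l) = (\<Sum>l=1..n. i l)" for i and j :: nat
    by (rule sum.cong) auto
  have prod_upd: "(\<Prod>l=1..n. fact ((i(Suc n := j)) l)) = (\<Prod>l=1..n. fact (i l) :: real)" for i j
    by (rule prod.cong) auto
  have "(\<Sum>j\<le>r. real (r choose j) * H_boxplus n f (r - j) ((H (f (Suc n)) ^^ j) w) x) =
      (\<Sum>j\<le>r. \<Sum>i\<in>S n (r - j). real (r choose j) * (fact (r - j) / (\<Prod>l=1..n. fact (i l)) *
          T n i ((H (f (Suc n)) ^^ j) w)))"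
    by (simp add: H_boxplus_def S_def T_def sum_distrib_left)
  also have "\<dots> = (\<Sum>(j, i)\<in>(SIGMA j:{..r}. S n (r - j)). real (r choose j) *
      (fact (r - j) / (\<Prod>l=1..n. fact (i l)) * T n i ((H (f (Suc n)) ^^ j) w)))"
    by (rule sum.Sigma) (auto simp: S_def finite_multi_indices[unfolded One_nat_def])
  also have "\<dots> = (\<Sum>i\<in>S (Suc n) r. fact r / (\<Prod>l=1..Suc n. fact (i l)) * T (Suc n) i w)"
  proof (rule sum.reindex_bij_witness[where
        i = "\<lambda>i. (i (Suc n), i(Suc n := undefined))" and j = "\<lambda>(j, i). i(Suc n := j)"], goal_cases)
    case (1 p)
    then show ?case by (auto simp: S_def PiE_iff extensional_def)
  next
    case (2 p)
    then obtain j i where p: "p = (j, i)" "j \<le> r" "i \<in> S n (r - j)" by auto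
    have "i l \<le> r" if "1 \<le> l" "l \<le> n" for l
      using S_le[OF p(3) that] by simp
    moreover have "(\<Sum>l=1..n. i l) = r - j" "i \<in> extensional {1..n}"
      using p(3) by (auto simp: S_def PiE_iff)
    ultimately show ?case
      using p(2) by (auto simp: p(1) S_def PiE_iff extensional_def sum_upd[simplified] le_Suc_eq)
  next
    case (3 i)
    then show ?case by auto
  next
    case (4 i)
    then have "i (Suc n) \<le> r" "(\<Sum>l=1..n. i l) + i (Suc n) = r" "i \<in> extensional {1..Suc n}"
      by (auto simp: S_def PiE_iff)
    moreover have "i l \<le> (\<Sum>l=1..n. i l)" if "1 \<le> l" "l \<le> n" for l
      using that by (intro member_le_sum) auto
    ultimately show ?case
      by (auto simp: S_def PiE_iff extensional_def sum_upd[simplified])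
  next
    case (5 p)
    then obtain j i where p: "p = (j, i)" "j \<le> r" "i \<in> S n (r - j)" by auto
    then show ?case
      by (simp add: T_upd prod_upd[simplified] binomial_fact field_simps)
  qed
  finally show ?thesis
    by (simp add: H_boxplus_def S_def T_def)
qed

lemma Ck_H_boxplus:
  assumes "\<And>i. i \<in> {1..n} \<Longrightarrow> Ck (r - 1) (f i)" and "Ck r w" and "q \<le> r"
  shows "Ck (r - q) (\<lambda>x. H_boxplus n f q w x)"
  using assms
proof (induction n arbitrary: r q w)
  case 0
  then show ?case
    by (cases "q = 0") (auto simp: H_boxplus_no_fields Ck_const)
next
  case (Suc n)
  have "Ck (r - q) (\<lambda>x. H_boxplus n f (q - j) ((H (f (Suc n)) ^^ j) w) x)" if "j \<le> q" for j
  proof -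
    have "Ck (r - j - (q - j)) (\<lambda>x. H_boxplus n f (q - j) ((H (f (Suc n)) ^^ j) w) x)"
    proof (rule Suc.IH)
      fix i assume "i \<in> {1..n}"
      then show "Ck (r - j - 1) (f i)"
        using Ck_antimono[OF Suc.prems(1)[of i], of "r - j - 1"] by auto
    next
      show "Ck (r - j) ((H (f (Suc n)) ^^ j) w)"
        using that Suc.prems by (intro Ck_H_funpow) auto
    qed (use that Suc.prems in auto)
    then show ?thesis
      using that by simp
  qed
  then show ?case
    unfolding H_boxplus_Suc by (intro Ck_sum Ck_mult Ck_const) auto
qed

section \<open>Expansion along switched trajectories\<close>

lemma switched_trajectory_Suc:
  assumes "switched_trajectory (Suc n) f t x y" and "t > 0"
  shows "switched_trajectory n f t x y"
    and "integral_curve (f (Suc n)) (real n * t) (real n * t + t) y"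
proof -
  note y = assms(1)[unfolded switched_trajectory_def]
  have cont: "continuous_on {0..real n * t + t} y"
    using y by (simp add: algebra_simps)
  then show "switched_trajectory n f t x y"
    using y assms(2) unfolding switched_trajectory_def
    by (auto elim: continuous_on_subset)
  have "(y has_vector_derivative f (Suc n) (y s)) (at s)"
    if "s \<in> {real n * t<..<real n * t + t}" for s
  proof -
    have "\<forall>s\<in>{(real (Suc n) - 1) * t..<real (Suc n) * t}. (y has_vector_derivative f (Suc n) (y s))
        (at s within {(real (Suc n) - 1) * t..real (Suc n) * t})"
      using y by (elim conjE) (drule bspec[of _ _ "Suc n"], auto)
    moreover have "(real (Suc n) - 1) * t = real n * t" "real (Suc n) * t = real n * t + t"
      by (simp_all add: algebra_simps)
    ultimately have "(y has_vector_derivative f (Suc n) (y s))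
        (at s within {real n * t..real n * t + t})"
      using that by simp
    moreover have "at s within {real n * t..real n * t + t} = at s"
      using that by (intro at_within_interior) auto
    ultimately show ?thesis by simp
  qed
  moreover have "continuous_on {real n * t..real n * t + t} y"
    using assms(2) by (intro continuous_on_subset[OF cont]) auto
  ultimately show "integral_curve (f (Suc n)) (real n * t) (real n * t + t) y"
    by (simp add: integral_curve_def)
qed

lemma eventually_at_right_0_less: "\<tau> > 0 \<Longrightarrow> \<forall>\<^sub>F t in at_right (0::real). 0 < t \<and> t < \<tau>"
  unfolding eventually_at_right_field by auto

text \<open>The filter \<open>nhds x\<^sub>o \<times>\<^sub>F at_right 0\<close> expresses that the starting point is close to \<open>x\<^sub>o\<close> and the
  switching time is small, independently of each other. The bounds have to be uniform in both,
  since the switching time will later be tied to the starting point.\<close>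

lemma eventually_switched_trajectory_confined:
  assumes "\<And>i. i \<in> {1..n} \<Longrightarrow> continuous_on UNIV (f i)" and "\<eta> > 0"
  shows "\<forall>\<^sub>F (x, t) in nhds x\<^sub>o \<times>\<^sub>F at_right 0. \<forall>y. switched_trajectory n f t x y \<longrightarrow>
    y ` {0..real n * t} \<subseteq> ball x\<^sub>o \<eta>"
  using assms
proof (induction n arbitrary: \<eta>)
  case 0
  have "\<forall>\<^sub>F (x, t) in nhds x\<^sub>o \<times>\<^sub>F at_right (0::real). x \<in> ball x\<^sub>o \<eta>"
    using 0 by (subst eventually_prod1) (simp_all add: eventually_nhds_in_open del: mem_ball)
  then show ?case
    by eventually_elim (auto simp: switched_trajectory_def)
next
  case (Suc n)
  obtain \<tau> where \<tau>: "\<tau> > 0" "\<And>a b y. a \<le> b \<Longrightarrow> b - a < \<tau> \<Longrightarrow> integral_curve (f (Suc n)) a b y \<Longrightarrow>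
    y a \<in> ball x\<^sub>o (\<eta> / 2) \<Longrightarrow> y ` {a..b} \<subseteq> ball x\<^sub>o \<eta>"
    using integral_curve_confined[of "f (Suc n)" \<eta> x\<^sub>o] Suc.prems by auto
  have "\<forall>\<^sub>F (x, t) in nhds x\<^sub>o \<times>\<^sub>F at_right 0. \<forall>y. switched_trajectory n f t x y \<longrightarrow>
      y ` {0..real n * t} \<subseteq> ball x\<^sub>o (\<eta> / 2)"
    using Suc.prems by (intro Suc.IH) auto
  moreover have "\<forall>\<^sub>F (x, t) in nhds x\<^sub>o \<times>\<^sub>F at_right 0. 0 < t \<and> t < \<tau>"
    using eventually_at_right_0_less[OF \<tau>(1)] by (subst eventually_prod2) auto
  ultimately show ?case
  proof eventually_elim
    case (elim p)
    obtain x t where p: "p = (x, t)" by fastforce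
    have t: "0 < t" "t < \<tau>" using elim(2) p by auto
    have "y ` {0..real (Suc n) * t} \<subseteq> ball x\<^sub>o \<eta>" if y: "switched_trajectory (Suc n) f t x y" for y
    proof -
      have init: "y ` {0..real n * t} \<subseteq> ball x\<^sub>o (\<eta> / 2)"
        using elim(1) p switched_trajectory_Suc(1)[OF y t(1)] by auto
      then have "y (real n * t) \<in> ball x\<^sub>o (\<eta> / 2)"
        using t by (auto simp: image_subset_iff)
      then have "y ` {real n * t..real n * t + t} \<subseteq> ball x\<^sub>o \<eta>"
        using t switched_trajectory_Suc(2)[OF y t(1)] by (intro \<tau>(2)) auto
      moreover have "{0..real (Suc n) * t} \<subseteq> {0..real n * t} \<union> {real n * t..real n * t + t}"
        by (auto simp: algebra_simps)
      moreover have "ball x\<^sub>o (\<eta> / 2) \<subseteq> ball x\<^sub>o \<eta>"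
        using Suc.prems by (intro subset_ball) auto
      ultimately show ?thesis
        using init by blast
    qed
    then show ?case by (auto simp: p)
  qed
qed

text \<open>Regrouping by total order \<open>q = j + p\<close>: the coefficients of the product of two exponential series
  are convolved with binomial weights, which matches the recursion of \<open>H_boxplus\<close>.\<close>

lemma sum_binomial_convolution:
  fixes b :: "nat \<Rightarrow> nat \<Rightarrow> real"
  shows "(\<Sum>j\<le>r. t ^ j / fact j * (\<Sum>p\<le>r - j. t ^ p / fact p * b p j)) =
    (\<Sum>q\<le>r. t ^ q / fact q * (\<Sum>j\<le>q. real (q choose j) * b (q - j) j))"
proof -
  have "(\<Sum>j\<le>r. t ^ j / fact j * (\<Sum>p\<le>r - j. t ^ p / fact p * b p j)) =
      (\<Sum>(j, p)\<in>(SIGMA j:{..r}. {..r - j}). t ^ j / fact j * (t ^ p / fact p * b p j))"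
    by (simp add: sum_distrib_left sum.Sigma)
  also have "(SIGMA j:{..r}. {..r - j}) = {(j, p). j + p \<le> r}"
    by auto
  also have "(\<Sum>(j, p)\<in>{(j, p). j + p \<le> r}. t ^ j / fact j * (t ^ p / fact p * b p j)) =
      (\<Sum>q\<le>r. \<Sum>j\<le>q. t ^ j / fact j * (t ^ (q - j) / fact (q - j) * b (q - j) j))"
    by (rule sum.triangle_reindex_eq)
  also have "\<dots> = (\<Sum>q\<le>r. t ^ q / fact q * (\<Sum>j\<le>q. real (q choose j) * b (q - j) j))"
  proof (intro sum.cong refl)
    fix q
    have "t ^ j / fact j * (t ^ (q - j) / fact (q - j) * b (q - j) j) =
        t ^ q / fact q * (real (q choose j) * b (q - j) j)" if "j \<le> q" for j
    proof -
      have "t ^ j * t ^ (q - j) = t ^ q"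
        using that by (simp flip: power_add)
      then show ?thesis
        using that by (simp add: binomial_fact)
    qed
    then show "(\<Sum>j\<le>q. t ^ j / fact j * (t ^ (q - j) / fact (q - j) * b (q - j) j)) =
        t ^ q / fact q * (\<Sum>j\<le>q. real (q choose j) * b (q - j) j)"
      by (simp add: sum_distrib_left)
  qed
  finally show ?thesis .
qed

text \<open>Up to the factors \<open>q!\<close>, \<open>H_boxplus n f q w\<close> are the Taylor coefficients of \<open>w\<close> along the concatenated flows:
  formally, \<open>w\<close> at the endpoint is \<open>exp (t H\<^sub>1) \<dots> exp (t H\<^sub>n) w\<close> at the starting point. The proof is
  by induction on the number of arcs. On the last arc \<open>w\<close> is expanded to order \<open>r\<close> around the last
  switching point \<open>z\<close>, and each coefficient \<open>H\<^sup>j w\<close>, being of class \<open>C\<^sup>r\<^sup>-\<^sup>j\<close>, is then expanded to order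
  \<open>r - j\<close> along the other arcs. Its error \<open>o(t\<^sup>r\<^sup>-\<^sup>j)\<close> is multiplied by \<open>t\<^sup>j\<close>, so every contribution is
  \<open>o(t\<^sup>r)\<close>.\<close>

lemma switched_trajectory_expansion:
  assumes "\<And>i. i \<in> {1..n} \<Longrightarrow> Ck (r - 1) (f i)" and "Ck r w" and "\<epsilon> > 0"
  shows "\<forall>\<^sub>F (x, t) in nhds x\<^sub>o \<times>\<^sub>F at_right 0. \<forall>y. switched_trajectory n f t x y \<longrightarrow>
    \<bar>w (y (real n * t)) - (\<Sum>q\<le>r. t ^ q / fact q * H_boxplus n f q w x)\<bar> \<le> \<epsilon> * t ^ r"
  using assms
proof (induction n arbitrary: r w \<epsilon>)
  case 0
  have "\<forall>\<^sub>F (x, t) in nhds x\<^sub>o \<times>\<^sub>F at_right (0::real). 0 < t"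
    using eventually_at_right_less[of "0::real"] by (subst eventually_prod2) auto
  moreover have "(\<Sum>q\<le>r. t ^ q / fact q * H_boxplus 0 f q w x) = w x" for t x
    by (simp add: H_boxplus_no_fields if_distrib sum.delta cong: if_cong)
  ultimately show ?case
    using \<open>\<epsilon> > 0\<close> by (auto elim!: eventually_mono simp: switched_trajectory_def)
next
  case (Suc n)
  define w' where "w' j = (H (f (Suc n)) ^^ j) w" for j
  \<comment> \<open>There are \<open>r + 2\<close> error terms: one from the last arc and one from each of the \<open>r + 1\<close>
    coefficients.\<close>
  define \<epsilon>' where "\<epsilon>' = \<epsilon> / (real r + 2)"
  have "\<epsilon>' > 0"
    using \<open>\<epsilon> > 0\<close> by (simp add: \<epsilon>'_def)
  obtain \<eta> where "\<eta> > 0" and taylor: "\<And>a t y. t > 0 \<Longrightarrow> integral_curve (f (Suc n)) a (a + t) y \<Longrightarrow>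
      y ` {a..a + t} \<subseteq> ball x\<^sub>o \<eta> \<Longrightarrow>
      \<bar>w (y (a + t)) - (\<Sum>j\<le>r. t ^ j / fact j * w' j (y a))\<bar> \<le> \<epsilon>' * t ^ r"
    using taylor_along_integral_curve[of r "f (Suc n)" w \<epsilon>' x\<^sub>o] Suc.prems \<open>\<epsilon>' > 0\<close>
    unfolding w'_def by auto
  have "\<forall>\<^sub>F (x, t) in nhds x\<^sub>o \<times>\<^sub>F at_right 0. \<forall>y. switched_trajectory (Suc n) f t x y \<longrightarrow>
      y ` {0..real (Suc n) * t} \<subseteq> ball x\<^sub>o \<eta>"
    using \<open>\<eta> > 0\<close> by (intro eventually_switched_trajectory_confined
        Ck_imp_continuous_on[OF Suc.prems(1)])
  moreover have "\<forall>\<^sub>F (x, t) in nhds x\<^sub>o \<times>\<^sub>F at_right (0::real). 0 < t"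
    using eventually_at_right_less[of "0::real"] by (subst eventually_prod2) auto
  moreover have "\<forall>\<^sub>F (x, t) in nhds x\<^sub>o \<times>\<^sub>F at_right 0. \<forall>y. switched_trajectory n f t x y \<longrightarrow>
      \<bar>w' j (y (real n * t)) - (\<Sum>p\<le>r - j. t ^ p / fact p * H_boxplus n f p (w' j) x)\<bar>
        \<le> \<epsilon>' * t ^ (r - j)" if "j \<le> r" for j
  proof (rule Suc.IH)
    fix i assume "i \<in> {1..n}"
    then show "Ck (r - j - 1) (f i)"
      using Ck_antimono[OF Suc.prems(1)[of i], of "r - j - 1"] by auto
  next
    show "Ck (r - j) (w' j)"
      unfolding w'_def using that Suc.prems by (intro Ck_H_funpow) auto
  qed fact
  then have "\<forall>\<^sub>F p in nhds x\<^sub>o \<times>\<^sub>F at_right 0. \<forall>j\<in>{..r}. case p of (x, t) \<Rightarrow>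
      \<forall>y. switched_trajectory n f t x y \<longrightarrow>
      \<bar>w' j (y (real n * t)) - (\<Sum>p\<le>r - j. t ^ p / fact p * H_boxplus n f p (w' j) x)\<bar>
        \<le> \<epsilon>' * t ^ (r - j)"
    by (intro eventually_ball_finite) auto
  ultimately show ?case
  proof eventually_elim
    case (elim p)
    obtain x t where p: "p = (x, t)" by fastforce
    have "t > 0" using elim(2) p by simp
    have "\<bar>w (y (real (Suc n) * t)) - (\<Sum>q\<le>r. t ^ q / fact q * H_boxplus (Suc n) f q w x)\<bar>
        \<le> \<epsilon> * t ^ r"
      if y: "switched_trajectory (Suc n) f t x y" for y
    proof -
      define P where "P j = (\<Sum>p\<le>r - j. t ^ p / fact p * H_boxplus n f p (w' j) x)" for j
      define z where "z = y (real n * t)"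
      have P: "\<bar>w' j z - P j\<bar> \<le> \<epsilon>' * t ^ (r - j)" if "j \<le> r" for j
        using elim(3) that switched_trajectory_Suc(1)[OF y \<open>t > 0\<close>] by (auto simp: p P_def z_def)
      have "{real n * t..real n * t + t} \<subseteq> {0..real (Suc n) * t}"
        using \<open>t > 0\<close> by (auto simp: algebra_simps intro: order_trans[rotated])
      moreover have "y ` {0..real (Suc n) * t} \<subseteq> ball x\<^sub>o \<eta>"
        using elim(1) y unfolding p by blast
      ultimately have "y ` {real n * t..real n * t + t} \<subseteq> ball x\<^sub>o \<eta>"
        by blast
      from taylor[OF \<open>t > 0\<close> switched_trajectory_Suc(2)[OF y \<open>t > 0\<close>] this]
      have main: "\<bar>w (y (real (Suc n) * t)) - (\<Sum>j\<le>r. t ^ j / fact j * w' j z)\<bar> \<le> \<epsilon>' * t ^ r"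
        by (simp add: z_def algebra_simps)
      have "\<bar>(\<Sum>j\<le>r. t ^ j / fact j * w' j z) - (\<Sum>j\<le>r. t ^ j / fact j * P j)\<bar>
          \<le> (\<Sum>j\<le>r. \<bar>t ^ j / fact j * (w' j z - P j)\<bar>)"
        by (simp add: right_diff_distrib flip: sum_subtractf)
      also have "\<dots> \<le> (\<Sum>j\<le>r. \<epsilon>' * t ^ r)"
      proof (rule sum_mono)
        fix j assume "j \<in> {..r}"
        have "\<bar>t ^ j / fact j * (w' j z - P j)\<bar> = t ^ j / fact j * \<bar>w' j z - P j\<bar>"
          using \<open>t > 0\<close> by (simp add: abs_mult)
        also have "\<dots> \<le> t ^ j * (\<epsilon>' * t ^ (r - j))"
          using \<open>t > 0\<close> P \<open>j \<in> {..r}\<close> fact_ge_1[of j, where 'a = real]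
          by (intro mult_mono) (auto simp: divide_le_eq)
        also have "\<dots> = \<epsilon>' * t ^ r"
          using \<open>j \<in> {..r}\<close> by (simp flip: power_add)
        finally show "\<bar>t ^ j / fact j * (w' j z - P j)\<bar> \<le> \<epsilon>' * t ^ r" .
      qed
      also have "\<dots> = (real r + 1) * (\<epsilon>' * t ^ r)"
        by (simp add: algebra_simps)
      finally have "\<bar>w (y (real (Suc n) * t)) - (\<Sum>j\<le>r. t ^ j / fact j * P j)\<bar>
          \<le> (real r + 2) * (\<epsilon>' * t ^ r)"
        using main by (simp add: algebra_simps)
      also have "(real r + 2) * (\<epsilon>' * t ^ r) = \<epsilon> * t ^ r"
        by (simp add: \<epsilon>'_def)
      also have "(\<Sum>j\<le>r. t ^ j / fact j * P j) = (\<Sum>q\<le>r. t ^ q / fact q * H_boxplus (Suc n) f q w x)"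
        unfolding P_def sum_binomial_convolution H_boxplus_Suc w'_def ..
      finally show ?thesis .
    qed
    then show ?case by (auto simp: p)
  qed
qed

section \<open>Decrease of the target function\<close>

lemma H_boxplus_0: "H_boxplus n f 0 w x = w x"
  by (induction n) (simp_all add: H_boxplus_no_fields H_boxplus_Suc)

lemma differentiable_imp_bounded_increment:
  fixes g :: "'a::real_normed_vector \<Rightarrow> 'b::real_normed_vector"
  assumes "g differentiable (at x\<^sub>o)"
  shows "\<exists>C>0. \<forall>\<^sub>F x in at x\<^sub>o. norm (g x - g x\<^sub>o) \<le> C * norm (x - x\<^sub>o)"
proof -
  obtain D where D: "(g has_derivative D) (at x\<^sub>o)"
    using assms by (auto simp: differentiable_def)
  then obtain d where "d > 0" and
    d: "\<And>x. norm (x - x\<^sub>o) < d \<Longrightarrow> norm (g x - g x\<^sub>o - D (x - x\<^sub>o)) \<le> 1 * norm (x - x\<^sub>o)"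
    unfolding has_derivative_at_alt using zero_less_one by blast
  obtain B where "B > 0" and B: "\<And>h. norm (D h) \<le> norm h * B"
    using bounded_linear.pos_bounded[OF has_derivative_bounded_linear[OF D]] by blast
  have "norm (g x - g x\<^sub>o) \<le> (1 + B) * norm (x - x\<^sub>o)" if "dist x x\<^sub>o < d" for x
  proof -
    have "norm (g x - g x\<^sub>o) \<le> norm (g x - g x\<^sub>o - D (x - x\<^sub>o)) + norm (D (x - x\<^sub>o))"
      by (metis diff_add_cancel norm_triangle_ineq)
    also have "\<dots> \<le> norm (x - x\<^sub>o) + norm (x - x\<^sub>o) * B"
      using d[of x] B that by (intro add_mono) (auto simp: dist_norm)
    finally show ?thesis
      by (simp add: algebra_simps)
  qed
  then have "\<forall>\<^sub>F x in at x\<^sub>o. norm (g x - g x\<^sub>o) \<le> (1 + B) * norm (x - x\<^sub>o)"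
    using \<open>d > 0\<close> by (auto simp: eventually_at)
  with \<open>B > 0\<close> show ?thesis
    by (intro exI[of _ "1 + B"]) auto
qed

lemma sum_increments_bound:
  fixes G :: "nat \<Rightarrow> real^'n \<Rightarrow> real"
  assumes "\<And>q. q < k \<Longrightarrow> G q differentiable (at x\<^sub>o)"
  shows "\<exists>C\<ge>0. \<forall>\<^sub>F x in at x\<^sub>o. (\<Sum>q<k. \<bar>G q x - G q x\<^sub>o\<bar>) \<le> C * norm (x - x\<^sub>o)"
proof -
  have "\<exists>C. \<forall>q\<in>{..<k}. 0 < C q \<and> (\<forall>\<^sub>F x in at x\<^sub>o. norm (G q x - G q x\<^sub>o) \<le> C q * norm (x - x\<^sub>o))"
    using differentiable_imp_bounded_increment[OF assms] by (intro bchoice) auto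
  then obtain C where C: "\<And>q. q < k \<Longrightarrow> 0 < C q"
    "\<And>q. q < k \<Longrightarrow> \<forall>\<^sub>F x in at x\<^sub>o. norm (G q x - G q x\<^sub>o) \<le> C q * norm (x - x\<^sub>o)"
    by blast
  then have "\<forall>\<^sub>F x in at x\<^sub>o. \<forall>q\<in>{..<k}. norm (G q x - G q x\<^sub>o) \<le> C q * norm (x - x\<^sub>o)"
    by (intro eventually_ball_finite) auto
  then have "\<forall>\<^sub>F x in at x\<^sub>o. (\<Sum>q<k. \<bar>G q x - G q x\<^sub>o\<bar>) \<le> (\<Sum>q<k. C q) * norm (x - x\<^sub>o)"
    by eventually_elim (auto simp: sum_distrib_right intro!: sum_mono)
  moreover have "(\<Sum>q<k. C q) \<ge> 0"
    using C(1) by (intro sum_nonneg) (auto intro: less_imp_le)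
  ultimately show ?thesis by blast
qed

lemma tendsto_powr_norm:
  fixes x\<^sub>o :: "'a::real_normed_vector"
  assumes "p > 0"
  shows "((\<lambda>x. c * norm (x - x\<^sub>o) powr p) \<longlongrightarrow> 0) (at x\<^sub>o)"
proof -
  have "((\<lambda>x. norm (x - x\<^sub>o)) \<longlongrightarrow> norm (x\<^sub>o - x\<^sub>o)) (at x\<^sub>o)"
    by (intro tendsto_intros)
  then have "((\<lambda>x. norm (x - x\<^sub>o)) \<longlongrightarrow> 0) (at x\<^sub>o)"
    by simp
  then have "((\<lambda>x. norm (x - x\<^sub>o) powr p) \<longlongrightarrow> 0) (at x\<^sub>o)"
    by (rule tendsto_zero_powrI[OF _ tendsto_const _ assms]) simp
  then show ?thesis
    by (rule tendsto_mult_right_zero)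
qed

text \<open>At \<open>x\<^sub>o\<close> the coefficients of orders \<open>1, \<dots>, k - 1\<close> vanish; at a nearby \<open>x\<close> they are differentiable
  functions that have moved away from their values at \<open>x\<^sub>o\<close> by at most \<open>C |x - x\<^sub>o|\<close> altogether. So
  \<open>u (y (m t)) - u x\<^sub>o \<le> C |x - x\<^sub>o| - c t\<^sup>k + o(t\<^sup>k)\<close>, where \<open>- c < 0\<close> is the Taylor coefficient of
  order \<open>k\<close> at \<open>x\<^sub>o\<close>. Choosing \<open>t\<close> as a large multiple \<open>K\<close> of
  \<open>|x - x\<^sub>o|\<^sup>1\<^sup>/\<^sup>k\<close> makes \<open>C |x - x\<^sub>o|\<close> at most half of \<open>c t\<^sup>k\<close>.\<close>

lemma decrease_along_switched_trajectories:
  fixes u :: "real^'n \<Rightarrow> real"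
  assumes "k > 0" and "Ck k u" and "\<And>i. i \<in> {1..m} \<Longrightarrow> Ck (k - 1) (f i)"
    and neg: "H_boxplus m f k u x\<^sub>o < 0"
    and zero: "\<And>j. j \<in> {1..k - 1} \<Longrightarrow> H_boxplus m f j u x\<^sub>o = 0"
    and "R > 0"
  obtains K where "K > 0" and "\<forall>\<^sub>F x in at x\<^sub>o. \<forall>t y. t = K * norm (x - x\<^sub>o) powr (1 / real k) \<longrightarrow>
    switched_trajectory m f t x y \<longrightarrow> y (real m * t) \<in> cball x\<^sub>o R \<and> u (y (real m * t)) \<le> u x\<^sub>o"
proof -
  define G where "G q x = H_boxplus m f q u x" for q x
  define c where "c = - G k x\<^sub>o / fact k"
  have "c > 0"
    using neg by (simp add: c_def G_def divide_neg_pos)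
  have Ck_G: "Ck (k - q) (G q)" if "q \<le> k" for q
    unfolding G_def using assms(2,3) that by (intro Ck_H_boxplus)
  have "G q differentiable (at x\<^sub>o)" if "q < k" for q
    using Ck_G[of q] that by (cases "k - q") auto
  then obtain C where "C \<ge> 0" and C: "\<forall>\<^sub>F x in at x\<^sub>o. (\<Sum>q<k. \<bar>G q x - G q x\<^sub>o\<bar>) \<le> C * norm (x - x\<^sub>o)"
    using sum_increments_bound[of k G x\<^sub>o] by blast
  \<comment> \<open>The summand \<open>1\<close> ensures \<open>K \<le> K\<^sup>k\<close>, so that \<open>K\<^sup>k\<close> inherits the lower bound \<open>2 C / c\<close>.\<close>
  define K where "K = 1 + 2 * C / c"
  have "K \<ge> 1"
    using \<open>c > 0\<close> \<open>C \<ge> 0\<close> by (simp add: K_def)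
  have "C \<le> c / 2 * K"
    using \<open>c > 0\<close> by (simp add: K_def field_simps)
  also have "\<dots> \<le> c / 2 * K ^ k"
    using \<open>c > 0\<close> \<open>K \<ge> 1\<close> \<open>k > 0\<close> self_le_power[of K k] by (intro mult_left_mono) auto
  finally have C_le: "C \<le> c / 2 * K ^ k" .
  define \<tau> where "\<tau> x = K * norm (x - x\<^sub>o) powr (1 / real k)" for x
  have \<tau>_pow: "\<tau> x ^ k = K ^ k * norm (x - x\<^sub>o)" for x
  proof -
    have "(norm (x - x\<^sub>o) powr (1 / real k)) ^ k = norm (x - x\<^sub>o)"
      using \<open>k > 0\<close> by (cases "x = x\<^sub>o") (simp_all add: powr_powr flip: powr_realpow)
    then show ?thesis
      by (simp add: \<tau>_def power_mult_distrib)
  qed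
  have "(\<tau> \<longlongrightarrow> 0) (at x\<^sub>o)"
    unfolding \<tau>_def using \<open>k > 0\<close> by (intro tendsto_powr_norm) simp
  moreover have \<tau>_pos: "\<forall>\<^sub>F x in at x\<^sub>o. \<tau> x > 0"
    using \<open>K \<ge> 1\<close> by (auto simp: \<tau>_def eventually_at_filter)
  ultimately have "filterlim \<tau> (at_right 0) (at x\<^sub>o)"
    by (auto simp: filterlim_at elim: eventually_mono)
  then have lim: "filterlim (\<lambda>x. (x, \<tau> x)) (nhds x\<^sub>o \<times>\<^sub>F at_right 0) (at x\<^sub>o)"
    by (intro filterlim_Pair tendsto_ident_at)
  \<comment> \<open>Half of \<open>c t\<^sup>k\<close> is reserved for the lower orders; a quarter each goes to the remainder and to
    the variation of the coefficient of order \<open>k\<close>.\<close>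
  have "\<forall>\<^sub>F x in at x\<^sub>o. \<forall>y. switched_trajectory m f (\<tau> x) x y \<longrightarrow>
      \<bar>u (y (real m * \<tau> x)) - (\<Sum>q\<le>k. \<tau> x ^ q / fact q * G q x)\<bar> \<le> c / 4 * \<tau> x ^ k"
    using eventually_compose_filterlim[OF
        switched_trajectory_expansion[of m k f u "c / 4" x\<^sub>o] lim] assms(2,3) \<open>c > 0\<close>
    by (auto simp: G_def)
  moreover have "\<forall>\<^sub>F x in at x\<^sub>o. \<forall>y. switched_trajectory m f (\<tau> x) x y \<longrightarrow>
      y ` {0..real m * \<tau> x} \<subseteq> ball x\<^sub>o R"
    using eventually_compose_filterlim[OF
        eventually_switched_trajectory_confined[of m f R x\<^sub>o] lim]
      Ck_imp_continuous_on[OF assms(3)] \<open>R > 0\<close>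
    by auto
  moreover have "\<forall>\<^sub>F x in at x\<^sub>o. \<tau> x < 1"
    using \<open>(\<tau> \<longlongrightarrow> 0) (at x\<^sub>o)\<close> by (rule order_tendstoD) simp
  moreover have "\<forall>\<^sub>F x in at x\<^sub>o. G k x / fact k < - c + c / 4"
  proof -
    have "isCont (G k) x\<^sub>o"
      using Ck_imp_continuous_on[OF Ck_G[of k], of UNIV] by (simp add: continuous_on_eq_continuous_at)
    then have "((\<lambda>x. G k x / fact k) \<longlongrightarrow> G k x\<^sub>o / fact k) (at x\<^sub>o)"
      by (auto intro!: tendsto_intros simp: isCont_def)
    then show ?thesis
      by (rule order_tendstoD) (use \<open>c > 0\<close> in \<open>simp add: c_def\<close>)
  qed
  ultimately have "\<forall>\<^sub>F x in at x\<^sub>o. \<forall>t y. t = K * norm (x - x\<^sub>o) powr (1 / real k) \<longrightarrow>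
    switched_trajectory m f t x y \<longrightarrow> y (real m * t) \<in> cball x\<^sub>o R \<and> u (y (real m * t)) \<le> u x\<^sub>o"
    using C \<tau>_pos
  proof eventually_elim
    case (elim x)
    define t where "t = \<tau> x"
    have "0 < t" "t < 1"
      using elim by (simp_all add: t_def)
    have "y (real m * t) \<in> cball x\<^sub>o R \<and> u (y (real m * t)) \<le> u x\<^sub>o"
      if y: "switched_trajectory m f t x y" for y
    proof
      have "y ` {0..real m * t} \<subseteq> ball x\<^sub>o R"
        using elim(2) y by (simp add: t_def)
      moreover have "real m * t \<in> {0..real m * t}"
        using \<open>0 < t\<close> by simp
      ultimately show "y (real m * t) \<in> cball x\<^sub>o R"
        using ball_subset_cball by blast
      have "(\<Sum>q<k. t ^ q / fact q * G q x\<^sub>o) = (\<Sum>q<k. if q = 0 then u x\<^sub>o else 0)"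
        using zero by (intro sum.cong) (auto simp: G_def H_boxplus_0)
      then have G_xo: "(\<Sum>q<k. t ^ q / fact q * G q x\<^sub>o) = u x\<^sub>o"
        using \<open>k > 0\<close> by simp
      have "(\<Sum>q<k. t ^ q / fact q * G q x) - u x\<^sub>o = (\<Sum>q<k. t ^ q / fact q * (G q x - G q x\<^sub>o))"
        by (simp only: right_diff_distrib sum_subtractf G_xo)
      also have "\<dots> \<le> (\<Sum>q<k. \<bar>G q x - G q x\<^sub>o\<bar>)"
      proof (rule sum_mono)
        fix q
        have "t ^ q \<le> fact q"
          by (rule order_trans[OF power_le_one fact_ge_1]) (use \<open>0 < t\<close> \<open>t < 1\<close> in auto)
        then have "t ^ q / fact q \<le> 1"
          by simp
        then have "t ^ q / fact q * \<bar>G q x - G q x\<^sub>o\<bar> \<le> \<bar>G q x - G q x\<^sub>o\<bar>"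
          by (rule mult_left_le_one_le[rotated 2]) (use \<open>0 < t\<close> in auto)
        moreover have "t ^ q / fact q * (G q x - G q x\<^sub>o) \<le> t ^ q / fact q * \<bar>G q x - G q x\<^sub>o\<bar>"
          using \<open>0 < t\<close> by (intro mult_left_mono) auto
        ultimately show "t ^ q / fact q * (G q x - G q x\<^sub>o) \<le> \<bar>G q x - G q x\<^sub>o\<bar>"
          by (rule order_trans[rotated])
      qed
      also have "\<dots> \<le> C * norm (x - x\<^sub>o)"
        by (fact elim)
      also have "\<dots> \<le> c / 2 * K ^ k * norm (x - x\<^sub>o)"
        using C_le by (intro mult_right_mono) auto
      also have "\<dots> = c / 2 * t ^ k"
        by (simp add: t_def \<tau>_pow)
      finally have low: "(\<Sum>q<k. t ^ q / fact q * G q x) \<le> u x\<^sub>o + c / 2 * t ^ k"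
        by simp
      have top: "t ^ k * (G k x / fact k) \<le> t ^ k * (- c + c / 4)"
        using elim(4) \<open>0 < t\<close> by (intro mult_left_mono) auto
      have "\<bar>u (y (real m * t)) - (\<Sum>q\<le>k. t ^ q / fact q * G q x)\<bar> \<le> c / 4 * t ^ k"
        using elim(1) y unfolding t_def by blast
      then have "u (y (real m * t)) \<le> (\<Sum>q\<le>k. t ^ q / fact q * G q x) + c / 4 * t ^ k"
        by (simp only: abs_diff_le_iff)
      also have "(\<Sum>q\<le>k. t ^ q / fact q * G q x) =
          (\<Sum>q<k. t ^ q / fact q * G q x) + t ^ k * (G k x / fact k)"
        by (simp flip: lessThan_Suc_atMost)
      also have "\<dots> + c / 4 * t ^ k \<le> u x\<^sub>o + c / 2 * t ^ k + t ^ k * (- c + c / 4) + c / 4 * t ^ k"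
        by (intro add_mono low top order_refl)
      also have "\<dots> = u x\<^sub>o"
        by (simp add: algebra_simps)
      finally show "u (y (real m * t)) \<le> u x\<^sub>o" .
    qed
    then show ?case
      by (simp add: t_def \<tau>_def)
  qed
  with \<open>K \<ge> 1\<close> show thesis
    by (intro that) auto
qed

section \<open>Switched trajectories as trajectories of the control system\<close>

text \<open>The control value on the \<open>i\<close>-th interval of length \<open>t\<close> is \<open>\<alpha> i\<close>; taking the minimum with \<open>m\<close> keeps
  the last value forever, since controls live on the whole half-line. For \<open>t = 0\<close> and \<open>m \<ge> 1\<close> the
  convention \<open>s / 0 = 0\<close> makes this the constant control \<open>\<alpha> 1\<close>.\<close>

definition switching_control :: "nat \<Rightarrow> (nat \<Rightarrow> 'c) \<Rightarrow> real \<Rightarrow> real \<Rightarrow> 'c" where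
  "switching_control m \<alpha> t s = \<alpha> (min m (nat \<lfloor>s / t\<rfloor> + 1))"

lemma switching_control_in_controls:
  assumes "m \<ge> 1" and "\<And>i. i \<in> {1..m} \<Longrightarrow> \<alpha> i \<in> A"
  shows "switching_control m \<alpha> t \<in> controls A"
proof -
  have "(\<lambda>s. min m (nat \<lfloor>s / t\<rfloor> + 1)) \<in> borel \<rightarrow>\<^sub>M count_space UNIV"
    by measurable
  then have "(\<lambda>s. \<alpha> (min m (nat \<lfloor>s / t\<rfloor> + 1))) \<in> borel \<rightarrow>\<^sub>M borel"
    by (rule measurable_compose) simp
  then have "(\<lambda>s. \<alpha> (min m (nat \<lfloor>s / t\<rfloor> + 1))) \<in> lebesgue \<rightarrow>\<^sub>M borel"
    by (intro measurable_completion) simp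
  then have "switching_control m \<alpha> t \<in> lebesgue_on {0<..} \<rightarrow>\<^sub>M borel"
    unfolding switching_control_def[abs_def] by (rule measurable_restrict_space1)
  with assms show ?thesis
    by (auto simp: controls_def switching_control_def)
qed

lemma switching_control_eq:
  assumes "t > 0" and "i \<in> {1..m}" and "s \<in> {(real i - 1) * t..<real i * t}"
  shows "switching_control m \<alpha> t s = \<alpha> i"
proof -
  have "real i - 1 \<le> s / t" "s / t < real i"
    using assms by (auto simp: field_simps)
  then have "\<lfloor>s / t\<rfloor> = int i - 1"
    by (simp add: floor_eq_iff)
  then have "min m (nat \<lfloor>s / t\<rfloor> + 1) = i"
    using assms(2) by auto
  then show ?thesis
    by (simp add: switching_control_def)
qed

text \<open>On each interval the integrand of the integral equation coincides, except at the right endpoint, with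
  the continuous function \<open>f i \<circ> y\<close>, so the fundamental theorem of calculus gives a classical
  derivative there. Together with well-posedness this produces switched trajectories for every
  starting point and every interval length.\<close>

lemma is_trajectory_imp_switched_trajectory:
  assumes y: "is_trajectory F (switching_control m \<alpha> t) x y" and "t \<ge> 0"
    and cont_f: "\<And>i. i \<in> {1..m} \<Longrightarrow> continuous_on UNIV (f i)"
    and f: "\<And>i z. i \<in> {1..m} \<Longrightarrow> f i z = F z (\<alpha> i)"
  shows "switched_trajectory m f t x y"
proof -
  define g where "g s = F (y s) (switching_control m \<alpha> t s)" for s
  have g: "g integrable_on {0..s}" and y_eq: "y s = x + integral {0..s} g" if "s \<ge> 0" for s
    using y that set_lebesgue_integral_eq_integral(1)[of "{0..s}" g]
    by (simp_all add: is_trajectory_def flip: g_def[abs_def])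
  have cont: "continuous_on {0..T} y" if "T \<ge> 0" for T
  proof -
    have "continuous_on {0..T} (\<lambda>s. x + integral {0..s} g)"
      using g[OF that] by (intro continuous_intros indefinite_integral_continuous_1)
    then show ?thesis
      by (rule continuous_on_eq) (simp add: y_eq)
  qed
  have "(y has_vector_derivative f i (y s)) (at s within {(real i - 1) * t..real i * t})"
    if i: "i \<in> {1..m}" and s: "s \<in> {(real i - 1) * t..<real i * t}" for i s
  proof -
    define p q where "p = (real i - 1) * t" and "q = real i * t"
    have "t > 0"
      using s \<open>t \<ge> 0\<close> by (cases "t = 0") auto
    have "p \<ge> 0" "p \<le> q"
      using i \<open>t > 0\<close> by (auto simp: p_def q_def)
    have "continuous_on {p..q} y"
      using cont[of q] \<open>p \<ge> 0\<close> \<open>p \<le> q\<close> by (auto elim!: continuous_on_subset)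
    then have "continuous_on {p..q} (\<lambda>s. f i (y s))"
      by (rule continuous_on_compose2[OF cont_f[OF i]]) simp
    then have D: "((\<lambda>r. integral {p..r} (\<lambda>v. f i (y v))) has_vector_derivative f i (y s))
        (at s within {p..q})"
      using s by (intro integral_has_vector_derivative) (auto simp: p_def q_def)
    have y_shift: "y r = y p + integral {p..r} (\<lambda>v. f i (y v))" if r: "r \<in> {p..q}" for r
    proof -
      have "integral {0..p} g + integral {p..r} g = integral {0..r} g"
        using \<open>p \<ge> 0\<close> r g[of r] by (intro Henstock_Kurzweil_Integration.integral_combine) auto
      moreover have "integral {p..r} g = integral {p..r} (\<lambda>v. f i (y v))"
      proof (rule integral_spike[of "{q}"])
        fix v assume "v \<in> {p..r} - {q}"
        then have "v \<in> {(real i - 1) * t..<real i * t}"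
          using r by (auto simp: p_def q_def)
        then show "f i (y v) = g v"
          using f[OF i] switching_control_eq[OF \<open>t > 0\<close> i, of v \<alpha>] by (simp add: g_def)
      qed simp
      ultimately show ?thesis
        using y_eq[of r] y_eq[of p] r \<open>p \<ge> 0\<close> by (simp add: algebra_simps)
    qed
    have "((\<lambda>r. y p + integral {p..r} (\<lambda>v. f i (y v))) has_vector_derivative f i (y s))
        (at s within {p..q})"
      using has_vector_derivative_add[OF has_vector_derivative_const D] by simp
    moreover have "s \<in> {p..q}"
      using s by (simp add: p_def q_def)
    ultimately have "(y has_vector_derivative f i (y s)) (at s within {p..q})"
      by (rule has_vector_derivative_transform[rotated 2]) (fact y_shift)
    then show ?thesis
      by (simp add: p_def q_def)
  qed
  moreover have "y 0 = x"
    using y_eq[of 0] by simp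
  ultimately show ?thesis
    using cont[of "real m * t"] \<open>t \<ge> 0\<close> by (simp add: switched_trajectory_def)
qed

lemma is_trajectory_trajectory:
  assumes "well_posed F A" and "a \<in> controls A"
  shows "is_trajectory F a x (trajectory F a x)"
proof -
  have "\<exists>y. is_trajectory F a x y"
    using assms unfolding well_posed_def by blast
  then show ?thesis
    unfolding trajectory_def by (rule someI_ex)
qed

lemma min_time_le:
  assumes "a \<in> controls A" and "t \<ge> 0" and "trajectory F a x t \<in> \<T>"
  shows "min_time F A \<T> x \<le> ennreal t"
proof -
  have "hitting_time \<T> (trajectory F a x) \<le> ennreal t"
    unfolding hitting_time_def using assms by (intro INF_lower) auto
  then show ?thesis
    unfolding min_time_def by (rule INF_lower2[OF assms(1)])
qed

lemma isCont_min_timeI: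
  assumes "p > 0" and "\<delta> > 0"
    and bound: "\<And>x. x \<in> cball x\<^sub>o \<delta> \<Longrightarrow> min_time F A \<T> x \<le> ennreal (C * norm (x - x\<^sub>o) powr p)"
  shows "isCont (min_time F A \<T>) x\<^sub>o"
proof -
  have "min_time F A \<T> x\<^sub>o = 0"
    using bound[of x\<^sub>o] \<open>\<delta> > 0\<close> by simp
  moreover have "(min_time F A \<T> \<longlongrightarrow> 0) (at x\<^sub>o)"
  proof (rule tendsto_sandwich[where f = "\<lambda>_. 0"])
    show "\<forall>\<^sub>F x in at x\<^sub>o. min_time F A \<T> x \<le> ennreal (C * norm (x - x\<^sub>o) powr p)"
      unfolding eventually_at using \<open>\<delta> > 0\<close>
      by (intro exI[of _ \<delta>]) (auto intro!: bound simp: dist_commute)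
    show "((\<lambda>x. ennreal (C * norm (x - x\<^sub>o) powr p)) \<longlongrightarrow> 0) (at x\<^sub>o)"
      using tendsto_ennrealI[OF tendsto_powr_norm[OF \<open>p > 0\<close>]] by simp
  qed auto
  ultimately show ?thesis
    by (simp add: isCont_def)
qed

section \<open>Attainability of the target\<close>

theorem theorem3p1:
  fixes F :: "real^'n \<Rightarrow> 'c::metric_space \<Rightarrow> real^'n"
    and A :: "'c set"
    and \<T> :: "(real^'n) set"
    and x\<^sub>o :: "real^'n"
    and R L :: real
    and u :: "real^'n \<Rightarrow> real"
    and k m :: nat
    and f :: "nat \<Rightarrow> real^'n \<Rightarrow> real^'n"
  assumes "compact A"
    and "continuous_on (UNIV \<times> A) (\<lambda>(x, a). F x a)"
    and "R > 0" and "L > 0"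
    and "\<And>x y a. x \<in> cball x\<^sub>o R \<Longrightarrow> y \<in> cball x\<^sub>o R \<Longrightarrow> a \<in> A \<Longrightarrow>
           norm (F x a - F y a) \<le> L * norm (x - y)"
    and "well_posed F A"
    and "closed \<T>"
    and "x\<^sub>o \<in> \<T> - interior \<T>"
    and "\<T> \<inter> cball x\<^sub>o R = {x \<in> cball x\<^sub>o R. u x \<le> u x\<^sub>o}"
    and "k > 0"
    and "Ck k u"
    and "grad u x\<^sub>o \<noteq> 0"
    and "\<And>i. i \<in> {1..m} \<Longrightarrow> available F A (f i)"
    and "\<And>i. i \<in> {1..m} \<Longrightarrow> Ck (k - 1) (f i)"
    and "H_boxplus m f k u x\<^sub>o < 0"
    and "\<And>j. j \<in> {1..k - 1} \<Longrightarrow> H_boxplus m f j u x\<^sub>o = 0"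
  shows "(\<exists>\<delta>>0. \<exists>\<delta>'>0. \<exists>K>0.
            (\<forall>x. norm (x - x\<^sub>o) \<le> \<delta>' \<longrightarrow>
               (\<exists>t\<in>{0..\<delta>}.
                  (\<exists>y. switched_trajectory m f t x y) \<and>
                  (\<forall>y. switched_trajectory m f t x y \<longrightarrow>
                     y (real m * t) \<in> cball x\<^sub>o R \<and> u (y (real m * t)) \<le> u x\<^sub>o) \<and>
                  t \<le> K * norm (x - x\<^sub>o) powr (1 / real k))) \<and>
            (\<forall>x\<in>cball x\<^sub>o \<delta>'.
               min_time F A \<T> x \<le> ennreal (K * real m * norm (x - x\<^sub>o) powr (1 / real k)))) \<and>
         isCont (min_time F A \<T>) x\<^sub>o \<and> STLA F A \<T> x\<^sub>o"
proof -
  note well_posed = \<open>well_posed F A\<close>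
  note Ck_f = \<open>\<And>i. i \<in> {1..m} \<Longrightarrow> Ck (k - 1) (f i)\<close>
  \<comment> \<open>Without fields the coefficient of order \<open>k > 0\<close> would be an empty sum.\<close>
  have "m \<ge> 1"
    using \<open>H_boxplus m f k u x\<^sub>o < 0\<close> \<open>k > 0\<close> by (cases "m = 0") (auto simp: H_boxplus_no_fields)
  have "\<exists>\<alpha>. \<forall>i\<in>{1..m}. \<alpha> i \<in> A \<and> (\<forall>z. f i z = F z (\<alpha> i))"
    using \<open>\<And>i. i \<in> {1..m} \<Longrightarrow> available F A (f i)\<close> unfolding available_def
    by (intro bchoice) blast
  then obtain \<alpha> where \<alpha>: "\<And>i. i \<in> {1..m} \<Longrightarrow> \<alpha> i \<in> A" "\<And>i z. i \<in> {1..m} \<Longrightarrow> f i z = F z (\<alpha> i)"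
    by blast
  define a where "a = switching_control m \<alpha>"
  have a_controls: "a t \<in> controls A" for t
    unfolding a_def using \<open>m \<ge> 1\<close> \<alpha>(1) by (rule switching_control_in_controls)
  have switched: "switched_trajectory m f t x (trajectory F (a t) x)" if "t \<ge> 0" for t x
    using is_trajectory_trajectory[OF well_posed a_controls] that Ck_f[THEN Ck_imp_continuous_on] \<alpha>(2)
    unfolding a_def by (rule is_trajectory_imp_switched_trajectory)
  obtain K where "K > 0" and ev: "\<forall>\<^sub>F x in at x\<^sub>o. \<forall>t y.
      t = K * norm (x - x\<^sub>o) powr (1 / real k) \<longrightarrow> switched_trajectory m f t x y \<longrightarrow>
      y (real m * t) \<in> cball x\<^sub>o R \<and> u (y (real m * t)) \<le> u x\<^sub>o"
    using decrease_along_switched_trajectories[OF \<open>k > 0\<close> \<open>Ck k u\<close> Ck_f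
        \<open>H_boxplus m f k u x\<^sub>o < 0\<close> \<open>\<And>j. j \<in> {1..k - 1} \<Longrightarrow> H_boxplus m f j u x\<^sub>o = 0\<close> \<open>R > 0\<close>]
    by blast
  define \<tau> where "\<tau> x = K * norm (x - x\<^sub>o) powr (1 / real k)" for x
  have \<tau>_nonneg: "\<tau> x \<ge> 0" for x
    using \<open>K > 0\<close> by (simp add: \<tau>_def)
  obtain d where "d > 0" and d: "\<And>x y. x \<noteq> x\<^sub>o \<Longrightarrow> dist x x\<^sub>o < d \<Longrightarrow>
      switched_trajectory m f (\<tau> x) x y \<Longrightarrow>
      y (real m * \<tau> x) \<in> cball x\<^sub>o R \<and> u (y (real m * \<tau> x)) \<le> u x\<^sub>o"
    using ev unfolding eventually_at \<tau>_def by blast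
  define \<delta>' where "\<delta>' = d / 2"
  have "\<delta>' > 0"
    using \<open>d > 0\<close> by (simp add: \<delta>'_def)
  have reach: "y (real m * \<tau> x) \<in> cball x\<^sub>o R \<and> u (y (real m * \<tau> x)) \<le> u x\<^sub>o"
    if "norm (x - x\<^sub>o) \<le> \<delta>'" and y: "switched_trajectory m f (\<tau> x) x y" for x y
    \<comment> \<open>At \<open>x\<^sub>o\<close> the switching time is \<open>0\<close> because \<open>0 powr p = 0\<close>, and nothing moves.\<close>
  proof (cases "x = x\<^sub>o")
    case True
    then show ?thesis
      using y \<open>R > 0\<close> by (simp add: \<tau>_def switched_trajectory_def)
  next
    case False
    then show ?thesis
      using that \<open>d > 0\<close> by (intro d) (auto simp: dist_norm \<delta>'_def)
  qed
  have bound: "min_time F A \<T> x \<le> ennreal (K * real m * norm (x - x\<^sub>o) powr (1 / real k))"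
    if "x \<in> cball x\<^sub>o \<delta>'" for x
  proof -
    have "trajectory F (a (\<tau> x)) x (real m * \<tau> x) \<in> \<T> \<inter> cball x\<^sub>o R"
      unfolding \<open>\<T> \<inter> cball x\<^sub>o R = {x \<in> cball x\<^sub>o R. u x \<le> u x\<^sub>o}\<close>
      using reach[OF _ switched[OF \<tau>_nonneg]] that by (simp add: dist_norm norm_minus_commute)
    then have "min_time F A \<T> x \<le> ennreal (real m * \<tau> x)"
      using a_controls \<tau>_nonneg by (intro min_time_le) auto
    then show ?thesis
      by (simp add: \<tau>_def mult_ac)
  qed
  have cont: "isCont (min_time F A \<T>) x\<^sub>o"
    using \<open>k > 0\<close> \<open>\<delta>' > 0\<close> bound by (intro isCont_min_timeI[of "1 / real k"]) auto
  have "\<exists>t\<in>{0..K * \<delta>' powr (1 / real k)}. (\<exists>y. switched_trajectory m f t x y) \<and>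
      (\<forall>y. switched_trajectory m f t x y \<longrightarrow>
        y (real m * t) \<in> cball x\<^sub>o R \<and> u (y (real m * t)) \<le> u x\<^sub>o) \<and>
      t \<le> K * norm (x - x\<^sub>o) powr (1 / real k)" if "norm (x - x\<^sub>o) \<le> \<delta>'" for x
  proof (intro bexI[of _ "\<tau> x"] conjI)
    show "\<tau> x \<in> {0..K * \<delta>' powr (1 / real k)}"
      using \<tau>_nonneg that \<open>K > 0\<close> by (auto simp: \<tau>_def intro!: powr_mono2)
  qed (use switched[OF \<tau>_nonneg] reach[OF that] in \<open>auto simp: \<tau>_def\<close>)
  moreover have "K * \<delta>' powr (1 / real k) > 0"
    using \<open>K > 0\<close> \<open>\<delta>' > 0\<close> by simp
  ultimately show ?thesis
    using \<open>\<delta>' > 0\<close> \<open>K > 0\<close> bound cont unfolding STLA_def by blast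
qed

end
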